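(* For any feedback control $\alpha=(\tilde\alpha_k)_k\in\mathcal{A}$, $$\mathbb{P}_{X_{k+1}^\alpha}=\Phi_{k+1}\big(\mathbb{P}_{X_k^\alpha},\tilde\alpha_k\big),\quad k\in\mathbb{N},\qquad \mathbb{P}_{X_0^\alpha}=\mathbb{P}_\xi,$$ where $\Phi_{k+1}$ is the measurable function defined from $\mathcal{P}_2(E)\times A^E$ into $\mathcal{P}_2(E)$ by $$\Phi_{k+1}(\mu,\tilde\alpha)(dx')=\int_E\mu(dx)\,P_{k+1}\big(x,\mu,\tilde\alpha(x),\tilde\alpha\star\mu,dx'\big).$$
   Context: $(E,|\cdot|)$ is a normed space and $(A,|\cdot|)$ is a normed space (typically a subset of $\mathbb{R}^m$), with $\sigma$-algebras $\mathcal{B}(E)$, $\mathcal{B}(A)$. $\mathcal{P}(E)$, $\mathcal{P}(A)$ are the sets of probability measures on $E$, $A$; $\|\mu\|_2^2:=\int|x|^2\mu(dx)$, and $\mathcal{P}_2(E)$ (resp. $\mathcal{P}_2(A)$) is the set of $\mu$ with $\|\mu\|_2<\infty$. On a probability space $(\Omega,\mathcal{F},\mathbb{P})$, $(\varepsilon_k)_{k\ge1}$ is an i.i.d. sequence of $\mathbb{R}^d$-valued random variables, independent of a square integrable $E$-valued random variable $\xi$. $\mathbb{P}_Y$ denotes the law of a random variable $Y$. The maps $F_{k+1}:E\times\mathcal{P}(E)\times A\times\mathcal{P}(A)\times\mathbb{R}^d\to E$, $k\in\mathbb{N}$, are measurable, and $P_{k+1}(x,\mu,a,\lambda,dx')$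 denotes the law of $F_{k+1}(x,\mu,a,\lambda,\varepsilon_{k+1})$. Standing assumption: for each $k\in\mathbb{N}$ there is a constant $C_{k,F}>0$ with $\mathbb{E}\big[|F_{k+1}(x,\mu,a,\lambda,\varepsilon_{k+1})|^2\big]\le C_{k,F}(1+|x|^2+|a|^2+\|\mu\|_2^2+\|\lambda\|_2^2)$ for all $(x,\mu,a,\lambda)\in E\times\mathcal{P}(E)\times A\times\mathcal{P}(A)$. $A^E$ is the set of measurable functions $\tilde\alpha:E\to A$ with linear growth ($|\tilde\alpha(x)|\le C(1+|x|)$ for some $C$). $\mathcal{A}$ is the set of admissible controls in closed-loop (feedback) form, identified with sequences $\alpha=(\tilde\alpha_k)_{k\in\mathbb{N}}$ in $A^E$; the associated state process is $X_0^\alpha=\xi$, $X_{k+1}^\alpha=F_{k+1}(X_k^\alpha,\mathbb{P}_{X_k^\alpha},\alpha_k,\mathbb{P}_{\alpha_k},\varepsilon_{k+1})$ with $\alpha_k=\tilde\alpha_k(X_k^\alpha)$. For $\tilde\alpha\in A^E$ and $\mu\in\mathcal{P}_2(E)$, $\tilde\alpha\star\mu\in\mathcal{P}_2(A)$ is the image (pushforward) of $\mu$ by $\tilde\alpha$: $(\tilde\alpha\star\mu)(B)=\mu(\tilde\alpha^{-1}(B))$ for $B\in\mathcal{B}(A)$. *)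

theory Defs
  imports "HOL-Probability.Probability"
begin

text \<open>
  The state space \<open>E\<close> is a type of class \<open>real_normed_vector\<close>. The action space is a set \<open>A\<close> in
  such a type, with the trace Borel sigma-algebra, so that both a full normed space
  (\<open>A = UNIV\<close>) and a subset of \<open>\<real>\<^sup>m\<close> are covered. Sets of probability measures carry
  the sigma-algebra generated by the evaluations \<open>\<mu> \<mapsto> \<mu> B\<close>, i.e. \<^const>\<open>prob_algebra\<close>.
\<close>

abbreviation borel_on :: "'a::topological_space set \<Rightarrow> 'a measure" where
  "borel_on A \<equiv> restrict_space borel A"

text \<open>\<open>\<parallel>\<mu>\<parallel>\<^sub>2\<^sup>2\<close>, which may be infinite.\<close>

definition second_moment :: "'e::real_normed_vector measure \<Rightarrow> ennreal" where
  "second_moment \<mu> = (\<integral>\<^sup>+ x. ennreal ((norm x)\<^sup>2) \<partial>\<mu>)"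

definition P2 :: "'e::real_normed_vector measure \<Rightarrow> 'e measure measure" where
  "P2 N = restrict_space (prob_algebra N) {\<mu>. second_moment \<mu> < \<infinity>}"

definition feedback_maps :: "'a::real_normed_vector set \<Rightarrow> ('e::real_normed_vector \<Rightarrow> 'a) set" where
  "feedback_maps A =
     {f \<in> borel \<rightarrow>\<^sub>M borel_on A. \<exists>C. \<forall>x. norm (f x) \<le> C * (1 + norm x)}"

definition pushforward ::
    "'a::real_normed_vector set \<Rightarrow> ('e::real_normed_vector \<Rightarrow> 'a) \<Rightarrow> 'e measure \<Rightarrow> 'a measure" where
  "pushforward A f \<mu> = distr \<mu> (borel_on A) f"

text \<open>
  Independence of two random variables with values in different types (the library's
  \<open>indep_var\<close> requires a common type): the generated sigma-algebras are independent.
\<close>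

definition indep_rv ::
    "'w measure \<Rightarrow> 'b measure \<Rightarrow> ('w \<Rightarrow> 'b) \<Rightarrow> 'c measure \<Rightarrow> ('w \<Rightarrow> 'c) \<Rightarrow> bool" where
  "indep_rv M N X L Y \<longleftrightarrow>
     X \<in> M \<rightarrow>\<^sub>M N \<and> Y \<in> M \<rightarrow>\<^sub>M L \<and>
     prob_space.indep_set M (sets (vimage_algebra (space M) X N)) (sets (vimage_algebra (space M) Y L))"

type_synonym ('e, 'a, 'r) dynamics =
  "nat \<Rightarrow> 'e \<Rightarrow> 'e measure \<Rightarrow> 'a \<Rightarrow> 'a measure \<Rightarrow> 'r \<Rightarrow> 'e"

text \<open>
  \<open>F k\<close>, \<open>\<epsilon> k\<close>, \<open>trans_kernel k\<close> and \<open>\<Phi> k\<close> are only meaningful for \<open>k \<ge> 1\<close>,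
  while states and controls are indexed from \<open>0\<close>.
\<close>

primrec state ::
    "'w measure \<Rightarrow> 'a::real_normed_vector set \<Rightarrow> ('e::real_normed_vector, 'a, 'r) dynamics
     \<Rightarrow> (nat \<Rightarrow> 'w \<Rightarrow> 'r) \<Rightarrow> ('w \<Rightarrow> 'e) \<Rightarrow> (nat \<Rightarrow> 'e \<Rightarrow> 'a) \<Rightarrow> nat \<Rightarrow> 'w \<Rightarrow> 'e" where
  "state M A F \<epsilon> \<xi> \<alpha> 0 = \<xi>"
| "state M A F \<epsilon> \<xi> \<alpha> (Suc k) =
     (\<lambda>\<omega>. F (Suc k)
       (state M A F \<epsilon> \<xi> \<alpha> k \<omega>)
       (distr M borel (state M A F \<epsilon> \<xi> \<alpha> k))
       (\<alpha> k (state M A F \<epsilon> \<xi> \<alpha> k \<omega>))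
       (distr M (borel_on A) (\<lambda>\<omega>'. \<alpha> k (state M A F \<epsilon> \<xi> \<alpha> k \<omega>')))
       (\<epsilon> (Suc k) \<omega>))"

definition trans_kernel ::
    "'w measure \<Rightarrow> ('e::real_normed_vector, 'a, 'r) dynamics \<Rightarrow> (nat \<Rightarrow> 'w \<Rightarrow> 'r)
     \<Rightarrow> nat \<Rightarrow> 'e \<Rightarrow> 'e measure \<Rightarrow> 'a \<Rightarrow> 'a measure \<Rightarrow> 'e measure" where
  "trans_kernel M F \<epsilon> k x \<mu> a \<nu> = distr M borel (\<lambda>\<omega>. F k x \<mu> a \<nu> (\<epsilon> k \<omega>))"

definition \<Phi> ::
    "'w measure \<Rightarrow> 'a::real_normed_vector set \<Rightarrow> ('e::real_normed_vector, 'a, 'r) dynamics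
     \<Rightarrow> (nat \<Rightarrow> 'w \<Rightarrow> 'r) \<Rightarrow> nat \<Rightarrow> 'e measure \<Rightarrow> ('e \<Rightarrow> 'a) \<Rightarrow> 'e measure" where
  "\<Phi> M A F \<epsilon> k \<mu> f =
     \<mu> \<bind> (\<lambda>x. trans_kernel M F \<epsilon> k x \<mu> (f x) (pushforward A f \<mu>))"

text \<open>
  Measure-valued maps on \<open>\<P>\<^sub>2(E) \<times> A\<^sup>E\<close>: on the function space there is
  in general no sigma-algebra that makes the evaluation map jointly measurable (Aumann), and already
  \<open>(\<mu>, f) \<mapsto> pushforward A f \<mu>\<close>, restricted to Dirac measures, amounts to evaluation.
  Joint measurability is therefore required for every sigma-algebra \<open>G\<close> on a subset of
  \<open>A\<^sup>E\<close> with measurable evaluation; besides, each section at a fixed \<open>f \<in> A\<^sup>E\<close>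
  is required to be measurable.
\<close>

definition measurable_P2_feedback ::
    "'a::real_normed_vector set \<Rightarrow> ('e::real_normed_vector measure \<Rightarrow> ('e \<Rightarrow> 'a) \<Rightarrow> 'e measure) \<Rightarrow> bool" where
  "measurable_P2_feedback A \<Psi> \<longleftrightarrow>
     (\<forall>f \<in> feedback_maps A. (\<lambda>\<mu>. \<Psi> \<mu> f) \<in> P2 borel \<rightarrow>\<^sub>M P2 borel) \<and>
     (\<forall>G. space G \<subseteq> feedback_maps A \<longrightarrow>
        (\<lambda>(f, x). f x) \<in> G \<Otimes>\<^sub>M borel \<rightarrow>\<^sub>M borel_on A \<longrightarrow>
        (\<lambda>(\<mu>, f). \<Psi> \<mu> f) \<in> P2 borel \<Otimes>\<^sub>M G \<rightarrow>\<^sub>M P2 borel)"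

end

theory Submission
  imports Defs
begin

text \<open>
  The state \<open>X\<^sub>k\<close> is a function of \<open>\<xi>, \<epsilon>\<^sub>1, \<dots>, \<epsilon>\<^sub>k\<close>, hence independent of
  \<open>\<epsilon>\<^sub>k\<^sub>+\<^sub>1\<close>. The law of the pair \<open>(X\<^sub>k, \<epsilon>\<^sub>k\<^sub>+\<^sub>1)\<close> is therefore a product, and integrating out the noise
  in the recursion first yields the kernel. The growth condition keeps second moments finite, so
  that the recursion stays in \<open>\<P>\<^sub>2(E)\<close>.
\<close>

section \<open>Laws of functions of two independent random variables\<close>

text \<open>A product of sigma-finite measures is determined by its values on rectangles, and there
  independence of the two preimage events gives the factorization. Families of preimages allow
  \<open>X\<close> and \<open>Y\<close> to have different value types.\<close>

lemma (in prob_space) distr_Pair_indep_set: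
  assumes X[measurable]: "X \<in> M \<rightarrow>\<^sub>M S" and Y[measurable]: "Y \<in> M \<rightarrow>\<^sub>M T"
    and indep: "indep_set {X -` B \<inter> space M |B. B \<in> sets S} {Y -` B \<inter> space M |B. B \<in> sets T}"
  shows "distr M (S \<Otimes>\<^sub>M T) (\<lambda>\<omega>. (X \<omega>, Y \<omega>)) = distr M S X \<Otimes>\<^sub>M distr M T Y"
proof (rule pair_measure_eqI[symmetric])
  show "sigma_finite_measure (distr M S X)"
    by (intro finite_measure.axioms prob_space.finite_measure prob_space_distr X)
  show "sigma_finite_measure (distr M T Y)"
    by (intro finite_measure.axioms prob_space.finite_measure prob_space_distr Y)
  show "sets (distr M S X \<Otimes>\<^sub>M distr M T Y) = sets (distr M (S \<Otimes>\<^sub>M T) (\<lambda>\<omega>. (X \<omega>, Y \<omega>)))"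
    by (simp cong: sets_pair_measure_cong)
  fix B C assume "B \<in> sets (distr M S X)" "C \<in> sets (distr M T Y)"
  then have [measurable]: "B \<in> sets S" "C \<in> sets T" by simp_all
  have "(\<lambda>\<omega>. (X \<omega>, Y \<omega>)) -` (B \<times> C) \<inter> space M = (X -` B \<inter> space M) \<inter> (Y -` C \<inter> space M)"
    by auto
  moreover have "prob ((X -` B \<inter> space M) \<inter> (Y -` C \<inter> space M))
      = prob (X -` B \<inter> space M) * prob (Y -` C \<inter> space M)"
    by (rule indep_setD[OF indep]) auto
  ultimately show "emeasure (distr M S X) B * emeasure (distr M T Y) C
      = emeasure (distr M (S \<Otimes>\<^sub>M T) (\<lambda>\<omega>. (X \<omega>, Y \<omega>))) (B \<times> C)"
    by (simp add: emeasure_distr emeasure_eq_measure ennreal_mult)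
qed

text \<open>Freezing: by Tonelli on the product law, \<open>Y\<close> can be integrated out with
  \<open>X\<close> held at a fixed value \<open>x\<close>, and the law of \<open>X\<close> then
  mixes the resulting kernels. The state will play the role of \<open>X\<close>, the next noise that
  of \<open>Y\<close>.\<close>

lemma (in prob_space) distr_indep_set_eq_bind:
  assumes X[measurable]: "X \<in> M \<rightarrow>\<^sub>M S" and Y[measurable]: "Y \<in> M \<rightarrow>\<^sub>M T"
    and indep: "indep_set {X -` B \<inter> space M |B. B \<in> sets S} {Y -` B \<inter> space M |B. B \<in> sets T}"
    and h[measurable]: "(\<lambda>(x, y). h x y) \<in> S \<Otimes>\<^sub>M T \<rightarrow>\<^sub>M R"
  shows "distr M R (\<lambda>\<omega>. h (X \<omega>) (Y \<omega>)) = distr M S X \<bind> (\<lambda>x. distr M R (\<lambda>\<omega>. h x (Y \<omega>)))"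
proof (rule measure_eqI)
  have M: "M \<in> space (prob_algebra M)"
    by (simp add: space_prob_algebra prob_space_axioms)
  have XS: "distr M S X \<in> space (prob_algebra S)"
    by (simp add: space_prob_algebra prob_space_distr)
  have K: "(\<lambda>x. distr M R (\<lambda>\<omega>. h x (Y \<omega>))) \<in> S \<rightarrow>\<^sub>M prob_algebra R"
    using M by (intro measurable_distr_prob_space2[where M=M]) measurable
  show "sets (distr M R (\<lambda>\<omega>. h (X \<omega>) (Y \<omega>)))
      = sets (distr M S X \<bind> (\<lambda>x. distr M R (\<lambda>\<omega>. h x (Y \<omega>))))"
    using sets_bind'[OF XS K] by simp
  interpret Q: prob_space "distr M T Y" by (rule prob_space_distr) fact
  fix B assume "B \<in> sets (distr M R (\<lambda>\<omega>. h (X \<omega>) (Y \<omega>)))"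
  then have B[measurable]: "B \<in> sets R" by simp
  have ind: "(\<lambda>(x, y). indicator B (h x y) :: ennreal) \<in> borel_measurable (S \<Otimes>\<^sub>M T)"
    by measurable
  have "emeasure (distr M R (\<lambda>\<omega>. h (X \<omega>) (Y \<omega>))) B
      = (\<integral>\<^sup>+ z. indicator B z \<partial>distr M R (\<lambda>\<omega>. h (X \<omega>) (Y \<omega>)))"
    by simp
  also have "\<dots> = (\<integral>\<^sup>+ \<omega>. indicator B (h (X \<omega>) (Y \<omega>)) \<partial>M)"
    by (rule nn_integral_distr) measurable
  also have "\<dots> = (\<integral>\<^sup>+ (x, y). indicator B (h x y) \<partial>distr M (S \<Otimes>\<^sub>M T) (\<lambda>\<omega>. (X \<omega>, Y \<omega>)))"
    using ind by (subst nn_integral_distr) simp_all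
  also have "\<dots> = (\<integral>\<^sup>+ x. \<integral>\<^sup>+ y. indicator B (h x y) \<partial>distr M T Y \<partial>distr M S X)"
    unfolding distr_Pair_indep_set[OF X Y indep]
    using ind by (subst Q.nn_integral_fst[symmetric]) (simp_all cong: measurable_cong_sets)
  also have "\<dots> = (\<integral>\<^sup>+ x. emeasure (distr M R (\<lambda>\<omega>. h x (Y \<omega>))) B \<partial>distr M S X)"
  proof (rule nn_integral_cong)
    fix x assume "x \<in> space (distr M S X)"
    then have [measurable]: "x \<in> space S" by simp
    have "(\<integral>\<^sup>+ y. indicator B (h x y) \<partial>distr M T Y) = (\<integral>\<^sup>+ \<omega>. indicator B (h x (Y \<omega>)) \<partial>M)"
      by (rule nn_integral_distr) measurable
    also have "\<dots> = (\<integral>\<^sup>+ z. indicator B z \<partial>distr M R (\<lambda>\<omega>. h x (Y \<omega>)))"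
      by (rule nn_integral_distr[symmetric]) measurable
    finally show "(\<integral>\<^sup>+ y. indicator B (h x y) \<partial>distr M T Y) = emeasure (distr M R (\<lambda>\<omega>. h x (Y \<omega>))) B"
      by simp
  qed
  also have "\<dots> = emeasure (distr M S X \<bind> (\<lambda>x. distr M R (\<lambda>\<omega>. h x (Y \<omega>)))) B"
    by (rule emeasure_bind_prob_algebra[OF XS K B, symmetric])
  finally show "emeasure (distr M R (\<lambda>\<omega>. h (X \<omega>) (Y \<omega>))) B
      = emeasure (distr M S X \<bind> (\<lambda>x. distr M R (\<lambda>\<omega>. h x (Y \<omega>)))) B" .
qed

section \<open>Finite second moments and feedback maps\<close>

lemma space_P2_iff:
  "\<mu> \<in> space (P2 N) \<longleftrightarrow> sets \<mu> = sets N \<and> prob_space \<mu> \<and> second_moment \<mu> < \<infinity>"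
  by (auto simp: P2_def space_restrict_space space_prob_algebra)

lemma measurable_P2_prob_algebra: "(\<lambda>\<mu>. \<mu>) \<in> P2 N \<rightarrow>\<^sub>M prob_algebra N"
  unfolding P2_def by (rule measurable_restrict_space1) simp

lemma feedback_maps_measurable: "f \<in> feedback_maps A \<Longrightarrow> f \<in> borel \<rightarrow>\<^sub>M borel_on A"
  by (simp add: feedback_maps_def)

text \<open>Linear growth is needed in quadratic form, so that it can be integrated against a
  measure with finite second moment.\<close>

lemma feedback_maps_norm_square_bound:
  assumes "f \<in> feedback_maps A"
  obtains D where "0 \<le> D" "\<And>x. (norm (f x))\<^sup>2 \<le> D * (1 + (norm x)\<^sup>2)"
proof -
  from assms obtain C where C: "\<And>x. norm (f x) \<le> C * (1 + norm x)"
    unfolding feedback_maps_def by blast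
  have "(norm (f x))\<^sup>2 \<le> (2 * C\<^sup>2) * (1 + (norm x)\<^sup>2)" for x
  proof -
    have "(norm (f x))\<^sup>2 \<le> (C * (1 + norm x))\<^sup>2"
      by (rule power_mono[OF C]) simp
    also have "\<dots> = C\<^sup>2 * (1 + norm x)\<^sup>2"
      by (simp add: power_mult_distrib)
    \<comment> \<open>The factor 2 comes from 2t \<le> 1 + t^2 with t = \<open>norm x\<close>. The
      resulting constant is nonnegative whatever the sign of \<open>C\<close>.\<close>
    also have "\<dots> \<le> C\<^sup>2 * (2 * (1 + (norm x)\<^sup>2))"
      using sum_squares_bound[of 1 "norm x"]
      by (intro mult_left_mono) (auto simp: power2_sum)
    finally show ?thesis by (simp add: algebra_simps)
  qed
  then show thesis by (intro that[of "2 * C\<^sup>2"]) auto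
qed

lemma norm_borel_on_measurable:
  "(\<lambda>a::'a::real_normed_vector. ennreal ((norm a)\<^sup>2)) \<in> borel_measurable (borel_on A)"
  by (rule measurable_restrict_space1) measurable

lemma pushforward_in_prob_algebra:
  assumes "\<mu> \<in> space (prob_algebra borel)" "f \<in> feedback_maps A"
  shows "pushforward A f \<mu> \<in> space (prob_algebra (borel_on A))"
  using assms feedback_maps_measurable[of f A]
  by (auto simp: pushforward_def space_prob_algebra cong: measurable_cong_sets
      intro!: prob_space.prob_space_distr)

lemma second_moment_pushforward:
  assumes "sets \<mu> = sets borel" "f \<in> feedback_maps A"
  shows "second_moment (pushforward A f \<mu>) = (\<integral>\<^sup>+ x. ennreal ((norm (f x))\<^sup>2) \<partial>\<mu>)"
  unfolding second_moment_def pushforward_def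
proof (rule nn_integral_distr)
  show "(\<lambda>a. ennreal ((norm a)\<^sup>2)) \<in> borel_measurable (distr \<mu> (borel_on A) f)"
    unfolding measurable_distr_eq1 by (rule norm_borel_on_measurable)
  show "f \<in> \<mu> \<rightarrow>\<^sub>M borel_on A"
    using assms(1) feedback_maps_measurable[OF assms(2)] by (simp cong: measurable_cong_sets)
qed

text \<open>Together with \<open>second_moment_pushforward\<close> this places
  \<open>pushforward A f \<mu>\<close> among the measures with finite second moment. Quadratic
  growth of \<open>f\<close> and total mass one reduce the integral to
  \<open>second_moment \<mu>\<close>.\<close>

lemma feedback_square_integral_finite:
  assumes \<mu>: "\<mu> \<in> space (P2 borel)" and f: "f \<in> feedback_maps A"
  shows "(\<integral>\<^sup>+ x. ennreal ((norm (f x))\<^sup>2) \<partial>\<mu>) < \<infinity>"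
proof -
  from \<mu> have [measurable_cong]: "sets \<mu> = sets borel" and "prob_space \<mu>"
    and fin: "second_moment \<mu> < \<infinity>"
    by (auto simp: space_P2_iff)
  interpret prob_space \<mu> by fact
  obtain D where D: "0 \<le> D" "\<And>x. (norm (f x))\<^sup>2 \<le> D * (1 + (norm x)\<^sup>2)"
    by (rule feedback_maps_norm_square_bound[OF f]) blast
  have "(\<integral>\<^sup>+ x. ennreal ((norm (f x))\<^sup>2) \<partial>\<mu>) \<le> (\<integral>\<^sup>+ x. ennreal D * (1 + ennreal ((norm x)\<^sup>2)) \<partial>\<mu>)"
  proof (rule nn_integral_mono)
    fix x
    have "ennreal ((norm (f x))\<^sup>2) \<le> ennreal (D * (1 + (norm x)\<^sup>2))"
      by (rule ennreal_leI) (rule D)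
    also have "\<dots> = ennreal D * (1 + ennreal ((norm x)\<^sup>2))"
      using D(1) by (simp add: ennreal_mult ennreal_plus flip: ennreal_1)
    finally show "ennreal ((norm (f x))\<^sup>2) \<le> ennreal D * (1 + ennreal ((norm x)\<^sup>2))" .
  qed
  also have "\<dots> = ennreal D * (1 + second_moment \<mu>)"
    by (simp add: nn_integral_cmult nn_integral_add second_moment_def emeasure_space_1)
  also have "\<dots> < \<infinity>"
    using fin by (simp add: ennreal_mult_less_top)
  finally show ?thesis .
qed

section \<open>The transition kernel and the map \<open>\<Phi>\<close> on measures with finite
  second moment\<close>

locale mean_field_dynamics = prob_space M
  for M :: "'w measure" +
  fixes A :: "'a::real_normed_vector set"
    and F :: "('e::real_normed_vector, 'a, 'r::topological_space) dynamics"
    and \<epsilon> :: "nat \<Rightarrow> 'w \<Rightarrow> 'r"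
  assumes noise_measurable: "\<And>k. \<epsilon> (Suc k) \<in> borel_measurable M"
    and dynamics_measurable: "\<And>k. (\<lambda>(x, \<mu>, a, \<nu>, e). F (Suc k) x \<mu> a \<nu> e)
        \<in> borel \<Otimes>\<^sub>M prob_algebra borel \<Otimes>\<^sub>M borel_on A \<Otimes>\<^sub>M prob_algebra (borel_on A) \<Otimes>\<^sub>M borel
          \<rightarrow>\<^sub>M borel"
    and dynamics_growth: "\<And>k. \<exists>C > 0. \<forall>x. \<forall>\<mu> \<in> space (prob_algebra borel).
        \<forall>a \<in> A. \<forall>\<nu> \<in> space (prob_algebra (borel_on A)).
          (\<integral>\<^sup>+ \<omega>. ennreal ((norm (F (Suc k) x \<mu> a \<nu> (\<epsilon> (Suc k) \<omega>)))\<^sup>2) \<partial>M)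
          \<le> ennreal C * (1 + ennreal ((norm x)\<^sup>2) + ennreal ((norm a)\<^sup>2)
              + second_moment \<mu> + second_moment \<nu>)"
begin

text \<open>All arguments, the measures included, may vary with a parameter in an arbitrary space
  \<open>L\<close>. Constant measures give the recursion of the state; varying ones give joint
  measurability of \<open>\<Phi>\<close>.\<close>

lemma dynamics_measurable_compose:
  assumes "x \<in> L \<rightarrow>\<^sub>M borel" "\<mu> \<in> L \<rightarrow>\<^sub>M prob_algebra borel" "a \<in> L \<rightarrow>\<^sub>M borel_on A"
    "\<nu> \<in> L \<rightarrow>\<^sub>M prob_algebra (borel_on A)" "e \<in> L \<rightarrow>\<^sub>M borel"
  shows "(\<lambda>l. F (Suc k) (x l) (\<mu> l) (a l) (\<nu> l) (e l)) \<in> L \<rightarrow>\<^sub>M borel"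
proof -
  have "(\<lambda>l. (x l, \<mu> l, a l, \<nu> l, e l)) \<in> L \<rightarrow>\<^sub>M
      borel \<Otimes>\<^sub>M prob_algebra borel \<Otimes>\<^sub>M borel_on A \<Otimes>\<^sub>M prob_algebra (borel_on A) \<Otimes>\<^sub>M borel"
    by (intro measurable_Pair assms)
  from measurable_compose[OF this dynamics_measurable[of k]] show ?thesis by simp
qed

text \<open>The kernel is the image of the constant kernel \<open>M\<close> under a map jointly
  measurable in the parameter and \<omega>.\<close>

lemma trans_kernel_measurable_compose:
  assumes "x \<in> L \<rightarrow>\<^sub>M borel" "\<mu> \<in> L \<rightarrow>\<^sub>M prob_algebra borel" "a \<in> L \<rightarrow>\<^sub>M borel_on A"
    "\<nu> \<in> L \<rightarrow>\<^sub>M prob_algebra (borel_on A)"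
  shows "(\<lambda>l. trans_kernel M F \<epsilon> (Suc k) (x l) (\<mu> l) (a l) (\<nu> l)) \<in> L \<rightarrow>\<^sub>M prob_algebra borel"
  unfolding trans_kernel_def
proof (rule measurable_distr_prob_space2)
  show "(\<lambda>_. M) \<in> L \<rightarrow>\<^sub>M prob_algebra M"
    by (simp add: space_prob_algebra prob_space_axioms)
  show "(\<lambda>(l, \<omega>). F (Suc k) (x l) (\<mu> l) (a l) (\<nu> l) (\<epsilon> (Suc k) \<omega>)) \<in> L \<Otimes>\<^sub>M M \<rightarrow>\<^sub>M borel"
    unfolding case_prod_beta
    by (intro dynamics_measurable_compose measurable_compose[OF measurable_fst]
        measurable_compose[OF measurable_snd noise_measurable] assms)
qed

lemma feedback_kernel_measurable:
  assumes "\<mu> \<in> space (prob_algebra borel)" "f \<in> feedback_maps A"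
  shows "(\<lambda>x. trans_kernel M F \<epsilon> (Suc k) x \<mu> (f x) (pushforward A f \<mu>)) \<in> borel \<rightarrow>\<^sub>M prob_algebra borel"
  using assms
  by (intro trans_kernel_measurable_compose measurable_const pushforward_in_prob_algebra
      feedback_maps_measurable) auto

lemma emeasure_\<Phi>:
  assumes "\<mu> \<in> space (prob_algebra borel)" "f \<in> feedback_maps A" "B \<in> sets borel"
  shows "emeasure (\<Phi> M A F \<epsilon> (Suc k) \<mu> f) B
    = (\<integral>\<^sup>+ x. emeasure (trans_kernel M F \<epsilon> (Suc k) x \<mu> (f x) (pushforward A f \<mu>)) B \<partial>\<mu>)"
  unfolding \<Phi>_def
  by (rule emeasure_bind_prob_algebra[OF assms(1) feedback_kernel_measurable assms(3)])
    (use assms in auto)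

text \<open>The growth bound, applied at each \<open>x\<close> with action \<open>f x\<close>, is
  integrated against \<open>\<mu>\<close>; the pushforward has finite second moment because
  \<open>f\<close> grows at most linearly.\<close>

lemma second_moment_\<Phi>_finite:
  assumes \<mu>: "\<mu> \<in> space (P2 borel)" and f: "f \<in> feedback_maps A"
  shows "second_moment (\<Phi> M A F \<epsilon> (Suc k) \<mu> f) < \<infinity>"
proof -
  from \<mu> have s[measurable_cong]: "sets \<mu> = sets borel" and "prob_space \<mu>"
    and fin: "second_moment \<mu> < \<infinity>"
    by (auto simp: space_P2_iff)
  interpret \<mu>: prob_space \<mu> by fact
  have \<mu>': "\<mu> \<in> space (prob_algebra borel)"
    using s \<open>prob_space \<mu>\<close> by (simp add: space_prob_algebra)
  define \<nu> where "\<nu> = pushforward A f \<mu>"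
  have \<nu>: "\<nu> \<in> space (prob_algebra (borel_on A))"
    unfolding \<nu>_def by (rule pushforward_in_prob_algebra[OF \<mu>' f])
  have \<nu>_eq: "second_moment \<nu> = (\<integral>\<^sup>+ x. ennreal ((norm (f x))\<^sup>2) \<partial>\<mu>)"
    unfolding \<nu>_def by (rule second_moment_pushforward[OF s f])
  note \<nu>_fin = feedback_square_integral_finite[OF \<mu> f]
  have fA: "f x \<in> A" for x
    using measurable_space[OF feedback_maps_measurable[OF f], of x]
    by (simp add: space_restrict_space)
  have f_norm: "(\<lambda>x. ennreal ((norm (f x))\<^sup>2)) \<in> borel_measurable \<mu>"
    using measurable_compose[OF feedback_maps_measurable[OF f] norm_borel_on_measurable]
    by (simp cong: measurable_cong_sets)
  obtain C where C: "\<And>x \<mu> a \<nu>. \<mu> \<in> space (prob_algebra borel) \<Longrightarrow> a \<in> A \<Longrightarrow>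
      \<nu> \<in> space (prob_algebra (borel_on A)) \<Longrightarrow>
      (\<integral>\<^sup>+ \<omega>. ennreal ((norm (F (Suc k) x \<mu> a \<nu> (\<epsilon> (Suc k) \<omega>)))\<^sup>2) \<partial>M)
          \<le> ennreal C * (1 + ennreal ((norm x)\<^sup>2) + ennreal ((norm a)\<^sup>2)
              + second_moment \<mu> + second_moment \<nu>)"
    using dynamics_growth[of k] by blast
  have kernel: "(\<lambda>x. trans_kernel M F \<epsilon> (Suc k) x \<mu> (f x) \<nu>) \<in> \<mu> \<rightarrow>\<^sub>M subprob_algebra borel"
    using measurable_prob_algebraD[OF feedback_kernel_measurable[OF \<mu>' f, of k]] s
    by (simp add: \<nu>_def cong: measurable_cong_sets)
  have "second_moment (\<Phi> M A F \<epsilon> (Suc k) \<mu> f)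
      = (\<integral>\<^sup>+ x. \<integral>\<^sup>+ y. ennreal ((norm y)\<^sup>2) \<partial>trans_kernel M F \<epsilon> (Suc k) x \<mu> (f x) \<nu> \<partial>\<mu>)"
    unfolding second_moment_def \<Phi>_def \<nu>_def[symmetric]
    by (rule nn_integral_bind[OF _ kernel]) measurable
  also have "\<dots> = (\<integral>\<^sup>+ x. \<integral>\<^sup>+ \<omega>. ennreal ((norm (F (Suc k) x \<mu> (f x) \<nu> (\<epsilon> (Suc k) \<omega>)))\<^sup>2) \<partial>M \<partial>\<mu>)"
    unfolding trans_kernel_def
    by (intro nn_integral_cong nn_integral_distr dynamics_measurable_compose measurable_const
        noise_measurable \<mu>' \<nu>)
      (auto simp: space_restrict_space fA)
  also have "\<dots> \<le> (\<integral>\<^sup>+ x. ennreal C * (1 + ennreal ((norm x)\<^sup>2) + ennreal ((norm (f x))\<^sup>2)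
              + second_moment \<mu> + second_moment \<nu>) \<partial>\<mu>)"
    by (intro nn_integral_mono C \<mu>' fA \<nu>)
  \<comment> \<open>The first two moments are the integrals of the squared norms of \<open>x\<close>
    and \<open>f x\<close>; the last two are constants of the growth bound, integrated against mass
    one.\<close>
  also have "\<dots> = ennreal C * (1 + second_moment \<mu> + second_moment \<nu> + second_moment \<mu> + second_moment \<nu>)"
    using f_norm
    by (simp add: nn_integral_cmult nn_integral_add \<mu>.emeasure_space_1 \<nu>_eq flip: second_moment_def)
  also have "\<dots> < \<infinity>"
    using fin \<nu>_fin \<nu>_eq by (simp add: ennreal_mult_less_top)
  finally show ?thesis .
qed

lemma \<Phi>_in_P2:
  assumes \<mu>: "\<mu> \<in> space (P2 borel)" and f: "f \<in> feedback_maps A"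
  shows "\<Phi> M A F \<epsilon> (Suc k) \<mu> f \<in> space (P2 borel)"
proof -
  have \<mu>': "\<mu> \<in> space (prob_algebra borel)"
    using \<mu> by (simp add: space_prob_algebra space_P2_iff)
  note K = feedback_kernel_measurable[OF \<mu>' f, of k]
  show ?thesis
    using prob_space_bind'[OF \<mu>' K] sets_bind'[OF \<mu>' K] second_moment_\<Phi>_finite[OF \<mu> f]
    by (simp add: space_P2_iff \<Phi>_def)
qed

text \<open>The control enters only through its values \<open>f x\<close> and its pushforward, and
  the latter is again an image under evaluation. Hence measurable evaluation reduces the claim to
  measurability of image and \<open>bind\<close> in their parameters.\<close>

lemma \<Phi>_jointly_measurable:
  assumes G: "space G \<subseteq> feedback_maps A"
    and eval: "(\<lambda>(f, x). f x) \<in> G \<Otimes>\<^sub>M borel \<rightarrow>\<^sub>M borel_on A"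
  shows "(\<lambda>(\<mu>, f). \<Phi> M A F \<epsilon> (Suc k) \<mu> f) \<in> P2 borel \<Otimes>\<^sub>M G \<rightarrow>\<^sub>M P2 borel"
proof -
  let ?L = "P2 borel \<Otimes>\<^sub>M G"
  \<comment> \<open>The parameter space stays generic because evaluation is used on products of
    \<open>?L\<close> with the state space, inside both the pushforward and the bind.\<close>
  have eval': "(\<lambda>q. g q (x q)) \<in> L \<rightarrow>\<^sub>M borel_on A"
    if "g \<in> L \<rightarrow>\<^sub>M G" "x \<in> L \<rightarrow>\<^sub>M borel" for g x and L :: "'l measure"
    using measurable_compose[OF measurable_Pair[OF that] eval] by simp
  have fst': "fst \<in> ?L \<rightarrow>\<^sub>M prob_algebra borel"
    by (rule measurable_compose[OF measurable_fst measurable_P2_prob_algebra])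
  have push: "(\<lambda>p. pushforward A (snd p) (fst p)) \<in> ?L \<rightarrow>\<^sub>M prob_algebra (borel_on A)"
    unfolding pushforward_def
    by (rule measurable_distr_prob_space2[OF fst'])
      (unfold case_prod_beta, intro eval' measurable_compose[OF measurable_fst measurable_snd]
        measurable_snd)
  have "(\<lambda>p. \<Phi> M A F \<epsilon> (Suc k) (fst p) (snd p)) \<in> ?L \<rightarrow>\<^sub>M prob_algebra borel"
    unfolding \<Phi>_def
    by (rule measurable_bind_prob_space2[OF fst'])
      (unfold case_prod_beta, intro trans_kernel_measurable_compose eval' measurable_snd
        measurable_compose[OF measurable_fst measurable_snd]
        measurable_compose[OF measurable_fst fst'] measurable_compose[OF measurable_fst push])
  \<comment> \<open>\<open>P2 borel\<close> carries the trace of \<open>prob_algebra borel\<close>,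
    so beyond measurability into the latter only membership of the values remains.\<close>
  moreover have "\<Phi> M A F \<epsilon> (Suc k) (fst p) (snd p) \<in> space (P2 borel)" if "p \<in> space ?L" for p
    using that G by (intro \<Phi>_in_P2) (auto simp: space_pair_measure)
  ultimately show ?thesis
    unfolding case_prod_beta
    by (subst P2_def) (rule measurable_restrict_space2, auto simp: space_P2_iff)
qed

lemma measurable_P2_feedback_\<Phi>: "measurable_P2_feedback A (\<Phi> M A F \<epsilon> (Suc k))"
  unfolding measurable_P2_feedback_def
proof (intro conjI ballI allI impI \<Phi>_jointly_measurable)
  fix f :: "'e \<Rightarrow> 'a" assume f: "f \<in> feedback_maps A"
  \<comment> \<open>A section at \<open>f\<close> is a case of the joint statement: on the one-point
    space \<open>{f}\<close>, evaluation is measurable because \<open>f\<close> is.\<close>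
  let ?G = "count_space {f}"
  have "(\<lambda>p. f (snd p)) \<in> ?G \<Otimes>\<^sub>M borel \<rightarrow>\<^sub>M borel_on A"
    by (rule measurable_compose[OF measurable_snd feedback_maps_measurable[OF f]])
  then have "(\<lambda>(g, x). g x) \<in> ?G \<Otimes>\<^sub>M borel \<rightarrow>\<^sub>M borel_on A"
    by (subst measurable_cong[where g = "\<lambda>p. f (snd p)"]) (auto simp: space_pair_measure)
  then have "(\<lambda>(\<mu>, f). \<Phi> M A F \<epsilon> (Suc k) \<mu> f) \<in> P2 borel \<Otimes>\<^sub>M ?G \<rightarrow>\<^sub>M P2 borel"
    using f by (intro \<Phi>_jointly_measurable) auto
  from measurable_compose[OF measurable_Pair2' this]
  show "(\<lambda>\<mu>. \<Phi> M A F \<epsilon> (Suc k) \<mu> f) \<in> P2 borel \<rightarrow>\<^sub>M P2 borel"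
    by simp
qed

section \<open>Measurability and one-step evolution of the state\<close>

text \<open>
  Measurability over an arbitrary \<open>\<sigma>\<close>-algebra \<open>N\<close> on \<open>\<Omega>\<close> is what makes the past of
  \<open>\<xi>, \<epsilon>\<close> available as \<open>N\<close>; the laws inside the recursion still refer to \<open>M\<close>.
\<close>

lemma state_measurable_wrt:
  assumes \<alpha>: "\<And>k. \<alpha> k \<in> feedback_maps A"
    and \<xi>: "\<xi> \<in> borel_measurable M"
    and N: "\<xi> \<in> borel_measurable N" "\<And>j. j < k \<Longrightarrow> \<epsilon> (Suc j) \<in> borel_measurable N"
  shows "state M A F \<epsilon> \<xi> \<alpha> k \<in> borel_measurable N"
proof -
  have law: "distr M borel X \<in> space (prob_algebra borel)"
    "distr M (borel_on A) (\<lambda>\<omega>. \<alpha> k (X \<omega>)) \<in> space (prob_algebra (borel_on A))"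
    if "X \<in> borel_measurable M" for X k
    using that measurable_compose[OF that feedback_maps_measurable[OF \<alpha>[of k]]]
    by (auto simp: space_prob_algebra intro!: prob_space_distr)
  \<comment> \<open>Measurability over \<open>M\<close> makes the two laws probability measures;
    measurability over \<open>L\<close> handles the dependence on \<omega>.\<close>
  have step: "state M A F \<epsilon> \<xi> \<alpha> (Suc k) \<in> borel_measurable L"
    if "state M A F \<epsilon> \<xi> \<alpha> k \<in> borel_measurable M" "state M A F \<epsilon> \<xi> \<alpha> k \<in> borel_measurable L"
      "\<epsilon> (Suc k) \<in> borel_measurable L" for L k
    unfolding state.simps
    by (intro dynamics_measurable_compose that measurable_const law
        measurable_compose[OF that(2) feedback_maps_measurable[OF \<alpha>]])
  \<comment> \<open>The case \<open>L = M\<close> comes first, since the step over \<open>N\<close>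
    presupposes it.\<close>
  have M: "state M A F \<epsilon> \<xi> \<alpha> k \<in> borel_measurable M" for k
    by (induction k) (auto simp del: state.simps(2) simp: \<xi> intro: step noise_measurable)
  show ?thesis
    using N(2) by (induction k) (auto simp del: state.simps(2) simp: N(1) intro: step M)
qed

text \<open>The laws of state and action are fixed measures, so the next state is a measurable
  function of the current state and the next noise alone. Freezing the state then produces
  \<open>trans_kernel\<close>, and the law of the action is the pushforward of the law of the
  state.\<close>

lemma distr_state_Suc:
  assumes f: "\<alpha> k \<in> feedback_maps A"
    and X: "state M A F \<epsilon> \<xi> \<alpha> k \<in> borel_measurable M"
    and indep: "indep_set {state M A F \<epsilon> \<xi> \<alpha> k -` B \<inter> space M |B. B \<in> sets borel}
      {\<epsilon> (Suc k) -` B \<inter> space M |B. B \<in> sets borel}"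
  shows "distr M borel (state M A F \<epsilon> \<xi> \<alpha> (Suc k))
    = \<Phi> M A F \<epsilon> (Suc k) (distr M borel (state M A F \<epsilon> \<xi> \<alpha> k)) (\<alpha> k)"
proof -
  let ?X = "state M A F \<epsilon> \<xi> \<alpha> k"
  let ?\<mu> = "distr M borel ?X"
  have \<mu>: "?\<mu> \<in> space (prob_algebra borel)"
    using X by (auto simp: space_prob_algebra intro!: prob_space_distr)
  have push: "distr M (borel_on A) (\<lambda>\<omega>. \<alpha> k (?X \<omega>)) = pushforward A (\<alpha> k) ?\<mu>"
    unfolding pushforward_def
    using distr_distr[OF feedback_maps_measurable[OF f] X] by (simp add: comp_def)
  have "(\<lambda>(x, e). F (Suc k) x ?\<mu> (\<alpha> k x) (pushforward A (\<alpha> k) ?\<mu>) e) \<in> borel \<Otimes>\<^sub>M borel \<rightarrow>\<^sub>M borel"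
    unfolding case_prod_beta
    by (intro dynamics_measurable_compose measurable_fst measurable_snd measurable_const \<mu>
        pushforward_in_prob_algebra f measurable_compose[OF measurable_fst feedback_maps_measurable])
  from distr_indep_set_eq_bind[OF X noise_measurable indep this]
  show ?thesis
    by (simp add: push \<Phi>_def trans_kernel_def)
qed

end

section \<open>Independence of the next noise from the past\<close>

text \<open>Index \<open>0\<close> stands for \<open>\<xi>\<close>, so that the initial value and the noise form one independent sequence.\<close>

definition source_events ::
    "'w measure \<Rightarrow> 'b measure \<Rightarrow> (nat \<Rightarrow> 'w \<Rightarrow> 'b) \<Rightarrow> 'c measure \<Rightarrow> ('w \<Rightarrow> 'c) \<Rightarrow> nat \<Rightarrow> 'w set set" where
  "source_events M L \<epsilon> N \<xi> i =
     (if i = 0 then {\<xi> -` B \<inter> space M |B. B \<in> sets N} else {\<epsilon> i -` B \<inter> space M |B. B \<in> sets L})"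

lemma Int_stable_vimages: "Int_stable {X -` B \<inter> \<Omega> |B. B \<in> sets N}"
  unfolding Int_stable_def
proof clarsimp
  fix B C assume "B \<in> sets N" "C \<in> sets N"
  then show "\<exists>D. X -` B \<inter> \<Omega> \<inter> (X -` C \<inter> \<Omega>) = X -` D \<inter> \<Omega> \<and> D \<in> sets N"
    by (intro exI[of _ "B \<inter> C"]) auto
qed

text \<open>In a finite intersection the event of \<open>\<xi>\<close> is split off by independence
  from the whole noise sequence; the remaining events factorize by independence of the noises among
  themselves.\<close>

lemma (in prob_space) indep_sets_source_events:
  assumes noise: "indep_vars (\<lambda>_. L) \<epsilon> {1..}"
    and init: "indep_rv M N \<xi> (\<Pi>\<^sub>M k\<in>{1..}. L) (\<lambda>\<omega>. \<lambda>k\<in>{1..}. \<epsilon> k \<omega>)"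
  shows "indep_sets (source_events M L \<epsilon> N \<xi>) UNIV"
proof (rule indep_setsI)
  let ?P = "\<Pi>\<^sub>M k\<in>{1::nat..}. L"
  let ?E = "\<lambda>\<omega>. \<lambda>k\<in>{1..}. \<epsilon> k \<omega>"
  let ?T = "sets (vimage_algebra (space M) ?E ?P)"
  have \<xi>: "\<xi> \<in> M \<rightarrow>\<^sub>M N" and E: "?E \<in> M \<rightarrow>\<^sub>M ?P"
    and ind: "indep_set (sets (vimage_algebra (space M) \<xi> N)) ?T"
    using init unfolding indep_rv_def by auto
  have \<epsilon>: "\<epsilon> i \<in> M \<rightarrow>\<^sub>M L" if "i \<ge> 1" for i
    using noise that by (auto simp: indep_vars_def2)
  have noise_sets: "indep_sets (source_events M L \<epsilon> N \<xi>) {1..}"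
    using noise unfolding indep_vars_def2
    by (subst indep_sets_cong[OF refl]) (auto simp: source_events_def)
  \<comment> \<open>Each coordinate \<open>\<epsilon> j\<close> is measurable for the sigma-algebra
    generated by the whole sequence, so events of single noises lie in \<open>?T\<close>.\<close>
  have "?E \<in> vimage_algebra (space M) ?E ?P \<rightarrow>\<^sub>M ?P"
    using measurable_space[OF E] by (intro measurable_vimage_algebra1) auto
  from measurable_compose[OF this measurable_component_singleton]
  have comp: "\<epsilon> j \<in> vimage_algebra (space M) ?E ?P \<rightarrow>\<^sub>M L" if "j \<ge> 1" for j
    using that by (force cong: measurable_cong)
  have in_T: "B \<in> ?T" if "j \<noteq> 0" "B \<in> source_events M L \<epsilon> N \<xi> j" for j B
    using that measurable_sets[OF comp[of j]] by (auto simp: source_events_def)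
  show "source_events M L \<epsilon> N \<xi> i \<subseteq> events" for i
    using \<xi> \<epsilon> by (auto simp: source_events_def)
  fix B and J :: "nat set"
  assume J: "J \<noteq> {}" "finite J" and B: "\<forall>j\<in>J. B j \<in> source_events M L \<epsilon> N \<xi> j"
  have pos: "prob (\<Inter>j\<in>K. B j) = (\<Prod>j\<in>K. prob (B j))" if "K \<subseteq> J" "K \<noteq> {}" "0 \<notin> K" for K
    using that J B
    by (intro indep_setsD[OF noise_sets]) (auto simp: Suc_le_eq intro: finite_subset gr0I)
  show "prob (\<Inter>j\<in>J. B j) = (\<Prod>j\<in>J. prob (B j))"
  proof (cases "0 \<in> J")
    case False
    then show ?thesis using pos[of J] J by simp
  next
    case True
    show ?thesis
    proof (cases "J = {0}")
      case False
      with True J have ne: "J - {0} \<noteq> {}" by auto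
      have "(\<Inter>j\<in>J - {0}. B j) \<in> ?T"
        using ne J B in_T by (intro sets.finite_INT) auto
      moreover have "B 0 \<in> sets (vimage_algebra (space M) \<xi> N)"
        using B True by (auto simp: source_events_def sets_vimage_algebra)
      ultimately have "prob (B 0 \<inter> (\<Inter>j\<in>J - {0}. B j)) = prob (B 0) * prob (\<Inter>j\<in>J - {0}. B j)"
        using indep_setD[OF ind] by blast
      moreover have "(\<Inter>j\<in>J. B j) = B 0 \<inter> (\<Inter>j\<in>J - {0}. B j)" using True by auto
      ultimately show ?thesis
        using pos[of "J - {0}"] ne J True by (simp add: prod.remove)
    qed simp
  qed
qed

text \<open>Independence of intersection-stable families passes to the sigma-algebras generated by
  disjoint blocks of indices, here \<open>{..k}\<close> and \<open>{Suc k}\<close>.\<close>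

lemma (in prob_space) indep_set_past_next:
  assumes noise: "indep_vars (\<lambda>_. L) \<epsilon> {1..}"
    and init: "indep_rv M N \<xi> (\<Pi>\<^sub>M k\<in>{1..}. L) (\<lambda>\<omega>. \<lambda>k\<in>{1..}. \<epsilon> k \<omega>)"
  shows "indep_set (sigma_sets (space M) (\<Union>i\<le>k. source_events M L \<epsilon> N \<xi> i))
    {\<epsilon> (Suc k) -` B \<inter> space M |B. B \<in> sets L}"
proof -
  let ?S = "source_events M L \<epsilon> N \<xi>"
  let ?I = "case_bool {..k} {Suc k}"
  have "indep_sets (\<lambda>b. sigma_sets (space M) (\<Union>i\<in>?I b. ?S i)) UNIV"
  proof (rule indep_sets_collect_sigma)
    show "indep_sets ?S (\<Union>b\<in>UNIV. ?I b)"
      using indep_sets_mono_index[OF _ indep_sets_source_events[OF noise init]] by blast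
    show "Int_stable (?S i)" for i
      by (simp add: source_events_def Int_stable_vimages)
    show "disjoint_family ?I"
      by (auto simp: disjoint_family_on_def split: bool.split)
  qed
  then show ?thesis
    \<comment> \<open>On the side of the next noise only the generating preimages are kept, the form
      required by \<open>distr_state_Suc\<close>.\<close>
    unfolding indep_set_def
    by (rule indep_sets_mono_sets) (auto simp: source_events_def split: bool.split)
qed

section \<open>Evolution of the laws along the recursion\<close>

theorem lemma3p2:
  fixes M :: "'w measure"
    and A :: "'a::real_normed_vector set"
    and F :: "('e::real_normed_vector, 'a, real ^ 'd) dynamics"
    and \<epsilon> :: "nat \<Rightarrow> 'w \<Rightarrow> real ^ 'd"
    and \<xi> :: "'w \<Rightarrow> 'e"
  assumes "prob_space M"
    and noise_indep: "prob_space.indep_vars M (\<lambda>_. borel) \<epsilon> {1..}"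
    and noise_ident: "\<And>k. k \<ge> 1 \<Longrightarrow> distr M borel (\<epsilon> k) = distr M borel (\<epsilon> 1)"
    and init_meas: "\<xi> \<in> borel_measurable M"
    and init_sq_int: "integrable M (\<lambda>\<omega>. (norm (\<xi> \<omega>))\<^sup>2)"
    and init_indep: "indep_rv M borel \<xi> (\<Pi>\<^sub>M k\<in>{1..}. borel) (\<lambda>\<omega>. \<lambda>k\<in>{1..}. \<epsilon> k \<omega>)"
    and F_meas: "\<And>k. (\<lambda>(x, \<mu>, a, \<nu>, e). F (Suc k) x \<mu> a \<nu> e)
        \<in> borel \<Otimes>\<^sub>M prob_algebra borel \<Otimes>\<^sub>M borel_on A \<Otimes>\<^sub>M prob_algebra (borel_on A) \<Otimes>\<^sub>M borel
          \<rightarrow>\<^sub>M borel"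
    and F_growth: "\<And>k. \<exists>C > 0. \<forall>x. \<forall>\<mu> \<in> space (prob_algebra borel).
        \<forall>a \<in> A. \<forall>\<nu> \<in> space (prob_algebra (borel_on A)).
          (\<integral>\<^sup>+ \<omega>. ennreal ((norm (F (Suc k) x \<mu> a \<nu> (\<epsilon> (Suc k) \<omega>)))\<^sup>2) \<partial>M)
          \<le> ennreal C * (1 + ennreal ((norm x)\<^sup>2) + ennreal ((norm a)\<^sup>2)
              + second_moment \<mu> + second_moment \<nu>)"
  shows
    "(\<forall>k. measurable_P2_feedback A (\<Phi> M A F \<epsilon> (Suc k)) \<and>
        (\<forall>\<mu> \<in> space (P2 borel). \<forall>f \<in> feedback_maps A. \<forall>B \<in> sets borel.
          emeasure (\<Phi> M A F \<epsilon> (Suc k) \<mu> f) B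
          = (\<integral>\<^sup>+ x. emeasure (trans_kernel M F \<epsilon> (Suc k) x \<mu> (f x) (pushforward A f \<mu>)) B \<partial>\<mu>))) \<and>
     (\<forall>\<alpha>. (\<forall>k. \<alpha> k \<in> feedback_maps A) \<longrightarrow>
        (\<forall>k. distr M borel (state M A F \<epsilon> \<xi> \<alpha> k) \<in> space (P2 borel) \<and>
          distr M borel (state M A F \<epsilon> \<xi> \<alpha> (Suc k))
          = \<Phi> M A F \<epsilon> (Suc k) (distr M borel (state M A F \<epsilon> \<xi> \<alpha> k)) (\<alpha> k)) \<and>
        distr M borel (state M A F \<epsilon> \<xi> \<alpha> 0) = distr M borel \<xi>)"
proof -
  interpret mean_field_dynamics M A F \<epsilon>
    using \<open>prob_space M\<close> noise_indep F_meas F_growth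
    by (simp add: mean_field_dynamics_def mean_field_dynamics_axioms_def prob_space.indep_vars_def2)
  have init: "distr M borel \<xi> \<in> space (P2 borel)"
  proof -
    have "second_moment (distr M borel \<xi>) = (\<integral>\<^sup>+ \<omega>. ennreal ((norm (\<xi> \<omega>))\<^sup>2) \<partial>M)"
      unfolding second_moment_def by (rule nn_integral_distr[OF init_meas]) measurable
    also have "\<dots> < \<infinity>"
      using init_sq_int by (simp add: integrable_iff_bounded)
    finally show ?thesis
      by (simp add: space_P2_iff prob_space_distr[OF init_meas])
  qed
  have main: "distr M borel (state M A F \<epsilon> \<xi> \<alpha> k) \<in> space (P2 borel) \<and>
      distr M borel (state M A F \<epsilon> \<xi> \<alpha> (Suc k))
      = \<Phi> M A F \<epsilon> (Suc k) (distr M borel (state M A F \<epsilon> \<xi> \<alpha> k)) (\<alpha> k)"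
    if \<alpha>: "\<And>k. \<alpha> k \<in> feedback_maps A" for \<alpha> k
  proof -
    have step: "distr M borel (state M A F \<epsilon> \<xi> \<alpha> (Suc k))
        = \<Phi> M A F \<epsilon> (Suc k) (distr M borel (state M A F \<epsilon> \<xi> \<alpha> k)) (\<alpha> k)" for k
    proof (rule distr_state_Suc[OF \<alpha>])
      show "state M A F \<epsilon> \<xi> \<alpha> k \<in> borel_measurable M"
        by (rule state_measurable_wrt[OF \<alpha> init_meas init_meas noise_measurable])
      let ?S = "source_events M borel \<epsilon> borel \<xi>"
      \<comment> \<open>This is the sigma-algebra generated by \<open>\<xi>\<close> and the noises
        up to time \<open>k\<close>. It serves as \<open>N\<close> in
        \<open>state_measurable_wrt\<close>.\<close>
      let ?past = "sigma (space M) (\<Union>i\<le>k. ?S i)"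
      have past: "space ?past = space M" "sets ?past = sigma_sets (space M) (\<Union>i\<le>k. ?S i)"
      proof -
        have "(\<Union>i\<le>k. ?S i) \<subseteq> Pow (space M)"
          by (auto simp: source_events_def split: if_splits)
        then show "space ?past = space M" "sets ?past = sigma_sets (space M) (\<Union>i\<le>k. ?S i)"
          by (simp_all add: space_measure_of_conv)
      qed
      have in_past: "B \<in> sets ?past" if "B \<in> ?S i" "i \<le> k" for B i
        unfolding past using that by (intro sigma_sets.Basic) auto
      have "\<xi> -` B \<inter> space M \<in> ?S 0" if "B \<in> sets borel" for B
        using that by (auto simp: source_events_def)
      then have "\<xi> \<in> borel_measurable ?past"
        by (intro measurableI) (simp_all only: past(1) in_past[of _ 0] le0 space_borel UNIV_I)
      moreover have "\<epsilon> (Suc j) \<in> borel_measurable ?past" if "j < k" for j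
      proof -
        have "\<epsilon> (Suc j) -` B \<inter> space M \<in> ?S (Suc j)" if "B \<in> sets borel" for B
          using that by (auto simp: source_events_def)
        then show ?thesis
          using that
          by (intro measurableI) (simp_all only: past(1) in_past[of _ "Suc j"] Suc_leI space_borel UNIV_I)
      qed
      ultimately have "state M A F \<epsilon> \<xi> \<alpha> k \<in> borel_measurable ?past"
        by (rule state_measurable_wrt[OF \<alpha> init_meas])
      then have "{state M A F \<epsilon> \<xi> \<alpha> k -` B \<inter> space M |B. B \<in> sets borel}
          \<subseteq> sigma_sets (space M) (\<Union>i\<le>k. ?S i)"
        using measurable_sets[of _ ?past borel] by (auto simp: past)
      \<comment> \<open>Preimages under the state are past events, so independence is inherited by
        passing to smaller families.\<close>
      with indep_set_past_next[OF noise_indep init_indep, of k]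
      show "indep_set {state M A F \<epsilon> \<xi> \<alpha> k -` B \<inter> space M |B. B \<in> sets borel}
          {\<epsilon> (Suc k) -` B \<inter> space M |B. B \<in> sets borel}"
        unfolding indep_set_def by (elim indep_sets_mono_sets) (auto split: bool.split)
    qed
    \<comment> \<open>The recursion for the laws is already available for every \<open>k\<close>, so
      the induction only iterates the invariance \<open>\<Phi>_in_P2\<close>, starting from square
      integrability of \<open>\<xi>\<close>.\<close>
    have "distr M borel (state M A F \<epsilon> \<xi> \<alpha> k) \<in> space (P2 borel)"
      by (induction k) (simp_all only: state.simps(1) init step \<Phi>_in_P2 \<alpha>)
    with step show ?thesis by blast
  qed
  show ?thesis
    using measurable_P2_feedback_\<Phi> main
    by (auto simp: space_P2_iff space_prob_algebra emeasure_\<Phi> simp del: state.simps(2))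
qed

end
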